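(* Let $\bm d\in\mathcal D$ and let $\bm g^{(\bm d)}$ be the performance potential vector, i.e. a solution of the Poisson equation $-\mathbf B^{(\bm d)}\bm g^{(\bm d)}=\bm f^{(\bm d)}-\eta^{\bm d}\bm e$. If $g^{(\bm d)}(0,0)=1$, then: For $k=1$, $$g^{(\bm d)}(1,0)=(-U_1)^{-1}\Big[h_1^{(\bm d)}+\sum_{j=2}^{m+n}X_j^{(1)}h_j^{(\bm d)}\Big]+G_1.$$ For $2\le k\le n$, $$g^{(\bm d)}(k,0)=(-U_k)^{-1}\Big[h_k^{(\bm d)}+\sum_{j=2}^{m+n-k+1}X_j^{(k)}h_{j+k-1}^{(\bm d)}\Big]+\sum_{i=1}^{k-1}Y_{k-i+1}^{(k)}(-U_i)^{-1}\Big[h_i^{(\bm d)}+\sum_{j=2}^{m+n-i+1}X_j^{(i)}h_{j+i-1}^{(\bm d)}\Big]+\prod_{j=1}^{k}G_j.$$ For $n+1\le k\le n+m-1$, $$g^{(\bm d)}(n,k-n)=(-U_k)^{-1}\Big[h_k^{(\bm d)}+\sum_{j=2}^{m+n-k+1}X_j^{(k)}h_{j+k-1}^{(\bm d)}\Big]+\sum_{i=1}^{k-1}Y_{k-i+1}^{(k)}(-U_i)^{-1}\Big[h_i^{(\bm d)}+\sum_{j=2}^{m+n-i+1}X_j^{(i)}h_{j+i-1}^{(\bm d)}\Big]+\prod_{j=1}^{k}G_j.$$ For $k=n+m$, $$g^{(\bm d)}(n,m)=(-U_{n+m})^{-1}h_{n+m}^{(\bm d)}+\sum_{i=1}^{n+m-1}Y_{n+m-i+1}^{(n+m)}(-U_i)^{-1}\Big[h_i^{(\bm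 d)}+\sum_{j=2}^{m+n-i+1}X_j^{(i)}h_{j+i-1}^{(\bm d)}\Big]+\prod_{j=1}^{n+m}G_j.$$
   Context: Model. Let $n,m\ge1$ be integers and $\lambda>0$, $\mu_1\ge\mu_2>0$. The state space is $\bm\Omega=\{(0,0),(1,0),\dots,(n,0),(n,1),\dots,(n,m)\}$ (in this order; $n+m+1$ states). A policy is $\bm d=(0,\dots,0;d_{n,1},\dots,d_{n,m})$ with $d_{n,j}\in\{0,1,\dots,m\}$ (and $d_{i,0}=0$ for $0\le i\le n$); $\mathcal D$ is the set of all policies. Put $\nu(d_{n,j})=n\mu_1+(d_{n,j}\wedge j)\mu_2$ for $1\le j\le m$, where $a\wedge b=\min(a,b)$. $\mathbf B^{(\bm d)}$ is the generator of the birth-death process on $\bm\Omega$ with birth rate $\lambda$ at every state except $(n,m)$ (birth rate $0$ there), death rate $i\mu_1$ at $(i,0)$ for $1\le i\le n$, and death rate $\nu(d_{n,j})$ at $(n,j)$ for $1\le j\le m$. $\bm\pi^{(\bm d)}$ is its unique stationary probability (row) vector, and $\bm e$ is the column vector of ones. Reward. Let $R\ge 0$, $P_{1,W}>0$, $0<P_{2,S}<P_{2,W}$, $C_1>0$, $0\le C_2^{(1)}\le C_2^{(2)}$, $C_3,C_4\ge0$ be constants. The reward column vector $\bm f^{(\bm d)}$ has entries, for $(i,j)\in\bm\Omega$, $$f^{(\bm d)}(i,j)=R[i\mu_1+(j\wedge d_{i,j})\mu_2]-[nP_{1,W}+d_{i,j}P_{2,W}+(m-d_{i,j})P_{2,S}]C_1-[iC_2^{(1)}+jC_2^{(2)}]-i\mu_1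 1_{\{j>0\}}C_3-\lambda 1_{\{i=n,j=m\}}C_4 .$$ The long-run average profit is $\eta^{\bm d}=\bm\pi^{(\bm d)}\bm f^{(\bm d)}$. Vector $\bm h^{(\bm d)}$. For $1\le k\le n$, $h_k^{(\bm d)}=f^{(\bm d)}(k,0)-\eta^{\bm d}$; for $n+1\le k\le n+m$, $h_k^{(\bm d)}=f^{(\bm d)}(n,k-n)-\eta^{\bm d}$. RG-measures (all depending on $\bm d$; these scalars $R_k$, $G_k$ are not to be confused with the price $R$). Let $A_1^{(k)}=-(\lambda+k\mu_1)$ for $1\le k\le n$, $A_1^{(k)}=-[\lambda+\nu(d_{n,k-n})]$ for $n+1\le k\le n+m-1$; $A_2^{(k)}=k\mu_1$ for $2\le k\le n$, $A_2^{(k)}=\nu(d_{n,k-n})$ for $n+1\le k\le n+m$. Define $U_{n+m}=-\nu(d_{n,m})$ and $U_k=A_1^{(k)}+\lambda(-U_{k+1})^{-1}A_2^{(k+1)}$ for $k=n+m-1,\dots,1$. Define $R_k=\lambda(-U_{k+1})^{-1}$ for $1\le k\le n+m-1$; $G_1=(-U_1)^{-1}\mu_1$ and $G_k=(-U_k)^{-1}A_2^{(k)}$ for $2\le k\le n+m$. Define $X_k^{(l)}=R_lR_{l+1}\cdots R_{l+k-2}$ for $k\ge2$, $l\ge1$, $l+k-2\le n+m-1$, and $Y_k^{(l)}=G_lG_{l-1}\cdots G_{l-k+2}$ for $2\le k\le l\le n+m$. *)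

theory Defs
  imports Complex_Main "HOL-Library.FuncSet"
begin

section \<open>The model\<close>

record params =
  n1 :: nat       \<comment> \<open>the integer \<open>n\<close>\<close>
  n2 :: nat       \<comment> \<open>the integer \<open>m\<close>\<close>
  lam :: real
  mu1 :: real
  mu2 :: real
  price :: real   \<comment> \<open>the service price \<open>R\<close>\<close>
  P1W :: real
  P2W :: real
  P2S :: real
  C1 :: real
  C2a :: real     \<comment> \<open>\<open>C\<^sub>2\<close> with superscript (1)\<close>
  C2b :: real     \<comment> \<open>\<open>C\<^sub>2\<close> with superscript (2)\<close>
  C3 :: real
  C4 :: real

definition valid_params :: "params \<Rightarrow> bool" where
  "valid_params p \<longleftrightarrow>
     1 \<le> n1 p \<and> 1 \<le> n2 p \<and> 0 < lam p \<and> mu2 p \<le> mu1 p \<and> 0 < mu2 p \<and>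
     0 \<le> price p \<and> 0 < P1W p \<and> 0 < P2S p \<and> P2S p < P2W p \<and> 0 < C1 p \<and>
     0 \<le> C2a p \<and> C2a p \<le> C2b p \<and> 0 \<le> C3 p \<and> 0 \<le> C4 p"

type_synonym state = "nat \<times> nat"
type_synonym policy = "state \<Rightarrow> nat"

definition Omega :: "params \<Rightarrow> state set" where
  "Omega p = {(i, 0) | i. i \<le> n1 p} \<union> {(n1 p, j) | j. 1 \<le> j \<and> j \<le> n2 p}"

definition policies :: "params \<Rightarrow> policy set" where
  "policies p = {d \<in> Omega p \<rightarrow>\<^sub>E {0..n2 p}. \<forall>i\<le>n1 p. d (i, 0) = 0}"

definition nu :: "params \<Rightarrow> policy \<Rightarrow> nat \<Rightarrow> real" where
  "nu p d j = real (n1 p) * mu1 p + real (min (d (n1 p, j)) j) * mu2 p"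

definition birth_rate :: "params \<Rightarrow> state \<Rightarrow> real" where
  "birth_rate p x = (if x = (n1 p, n2 p) then 0 else lam p)"

definition death_rate :: "params \<Rightarrow> policy \<Rightarrow> state \<Rightarrow> real" where
  "death_rate p d x = (case x of (i, j) \<Rightarrow> if j = 0 then real i * mu1 p else nu p d j)"

text \<open>The place of \<open>(i, j)\<close> in the ordering
  \<open>(0,0), (1,0), \<dots>, (n,0), (n,1), \<dots>, (n,m)\<close> of the state space, counted from 0, is \<open>i + j\<close>.\<close>

definition pos :: "state \<Rightarrow> nat" where
  "pos x = fst x + snd x"

definition B :: "params \<Rightarrow> policy \<Rightarrow> state \<Rightarrow> state \<Rightarrow> real" where
  "B p d x y =
     (if pos y = pos x + 1 then birth_rate p x
      else if pos x = pos y + 1 then death_rate p d x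
      else if x = y then - (birth_rate p x + death_rate p d x)
      else 0)"

text \<open>Vectors over the state space are functions; extensionality removes the irrelevant values
  outside \<open>Omega\<close>, so that the stationary probability vector is unique as a function
  (lemma \<open>ex1_stationary\<close> below).\<close>

definition is_stationary :: "params \<Rightarrow> policy \<Rightarrow> (state \<Rightarrow> real) \<Rightarrow> bool" where
  "is_stationary p d q \<longleftrightarrow>
     q \<in> extensional (Omega p) \<and>
     (\<forall>x\<in>Omega p. 0 \<le> q x) \<and> (\<Sum>x\<in>Omega p. q x) = 1 \<and>
     (\<forall>y\<in>Omega p. (\<Sum>x\<in>Omega p. q x * B p d x y) = 0)"

definition stat :: "params \<Rightarrow> policy \<Rightarrow> state \<Rightarrow> real" where
  "stat p d = (THE q. is_stationary p d q)"

definition reward :: "params \<Rightarrow> policy \<Rightarrow> state \<Rightarrow> real" where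
  "reward p d x = (case x of (i, j) \<Rightarrow>
     price p * (real i * mu1 p + real (min j (d (i, j))) * mu2 p)
     - (real (n1 p) * P1W p + real (d (i, j)) * P2W p
        + (real (n2 p) - real (d (i, j))) * P2S p) * C1 p
     - (real i * C2a p + real j * C2b p)
     - real i * mu1 p * of_bool (j > 0) * C3 p
     - lam p * of_bool (i = n1 p \<and> j = n2 p) * C4 p)"

definition eta :: "params \<Rightarrow> policy \<Rightarrow> real" where
  "eta p d = (\<Sum>x\<in>Omega p. stat p d x * reward p d x)"

definition is_potential :: "params \<Rightarrow> policy \<Rightarrow> (state \<Rightarrow> real) \<Rightarrow> bool" where
  "is_potential p d g \<longleftrightarrow>
     (\<forall>x\<in>Omega p. - (\<Sum>y\<in>Omega p. B p d x y * g y) = reward p d x - eta p d)"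

definition h :: "params \<Rightarrow> policy \<Rightarrow> nat \<Rightarrow> real" where
  "h p d k = (if k \<le> n1 p then reward p d (k, 0) else reward p d (n1 p, k - n1 p)) - eta p d"


section \<open>RG-measures\<close>

definition A1 :: "params \<Rightarrow> policy \<Rightarrow> nat \<Rightarrow> real" where
  "A1 p d k = (if k \<le> n1 p then - (lam p + real k * mu1 p) else - (lam p + nu p d (k - n1 p)))"

definition A2 :: "params \<Rightarrow> policy \<Rightarrow> nat \<Rightarrow> real" where
  "A2 p d k = (if k \<le> n1 p then real k * mu1 p else nu p d (k - n1 p))"

text \<open>Only the indices \<open>1 \<le> k \<le> n + m\<close> of \<open>U\<close> are meaningful; the recursion runs downwards
  from \<open>k = n + m\<close>. The index ranges of \<open>Rm\<close>, \<open>Gm\<close>, \<open>X\<close> and \<open>Y\<close> are likewise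
  those for which only such \<open>U\<close> are used.\<close>

function U :: "params \<Rightarrow> policy \<Rightarrow> nat \<Rightarrow> real" where
  "U p d k =
     (if k \<ge> n1 p + n2 p then - nu p d (n2 p)
      else A1 p d k + lam p * inverse (- U p d (k + 1)) * A2 p d (k + 1))"
  by pat_completeness auto
termination
  by (relation "measure (\<lambda>(p, d, k). n1 p + n2 p - k)") auto

declare U.simps [simp del]

definition Rm :: "params \<Rightarrow> policy \<Rightarrow> nat \<Rightarrow> real" where
  "Rm p d k = lam p * inverse (- U p d (k + 1))"

definition Gm :: "params \<Rightarrow> policy \<Rightarrow> nat \<Rightarrow> real" where
  "Gm p d k = (if k = 1 then inverse (- U p d 1) * mu1 p else inverse (- U p d k) * A2 p d k)"

text \<open>\<open>X p d k l\<close> is \<open>R\<^sub>l R\<^bsub>l+1\<^esub> \<dots> R\<^bsub>l+k-2\<^esub>\<close> (superscript \<open>l\<close>, subscript \<open>k \<ge> 2\<close>) and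
  \<open>Y p d k l\<close> is \<open>G\<^sub>l G\<^bsub>l-1\<^esub> \<dots> G\<^bsub>l-k+2\<^esub>\<close> (superscript \<open>l\<close>, subscript \<open>2 \<le> k \<le> l\<close>).\<close>

definition X :: "params \<Rightarrow> policy \<Rightarrow> nat \<Rightarrow> nat \<Rightarrow> real" where
  "X p d k l = (\<Prod>i\<in>{l..l + k - 2}. Rm p d i)"

definition Y :: "params \<Rightarrow> policy \<Rightarrow> nat \<Rightarrow> nat \<Rightarrow> real" where
  "Y p d k l = (\<Prod>i\<in>{l - k + 2..l}. Gm p d i)"


section \<open>Existence and uniqueness of the stationary probability vector\<close>

definition st :: "params \<Rightarrow> nat \<Rightarrow> state" where
  "st p k = (if k \<le> n1 p then (k, 0) else (n1 p, k - n1 p))"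

lemma pos_st [simp]: "pos (st p k) = k"
  by (simp add: st_def pos_def)

lemma bij_st: "bij_betw (st p) {..n1 p + n2 p} (Omega p)"
proof (rule bij_betw_imageI)
  show "inj_on (st p) {..n1 p + n2 p}"
    by (rule inj_on_inverseI[where g = pos]) simp
  show "st p ` {..n1 p + n2 p} = Omega p"
  proof
    show "st p ` {..n1 p + n2 p} \<subseteq> Omega p"
      by (auto simp: st_def Omega_def)
    show "Omega p \<subseteq> st p ` {..n1 p + n2 p}"
    proof
      fix x assume "x \<in> Omega p"
      then have "x = st p (pos x)" "pos x \<le> n1 p + n2 p"
        by (auto simp: Omega_def st_def pos_def)
      then show "x \<in> st p ` {..n1 p + n2 p}" by blast
    qed
  qed
qed

lemma sum_Omega: "(\<Sum>x\<in>Omega p. F x) = (\<Sum>k\<le>n1 p + n2 p. F (st p k))"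
  using sum.reindex_bij_betw[OF bij_st, of F p] by simp

lemma ball_Omega: "(\<forall>x\<in>Omega p. P x) \<longleftrightarrow> (\<forall>k\<le>n1 p + n2 p. P (st p k))"
proof -
  have "Omega p = st p ` {..n1 p + n2 p}"
    by (rule bij_betw_imp_surj_on[OF bij_st, symmetric])
  then show ?thesis by (simp only: ball_simps atMost_iff) auto
qed

lemma st_eq_iff: "st p k = st p l \<longleftrightarrow> k = l"
proof
  assume "st p k = st p l"
  then have "pos (st p k) = pos (st p l)" by (rule arg_cong)
  then show "k = l" by (simp only: pos_st)
qed (rule arg_cong)

lemma balance_iff:
  fixes a e q :: "nat \<Rightarrow> real"
  assumes e0: "e 0 = 0" and aN: "a N = 0"
  shows "(\<forall>l\<le>N. (\<Sum>k\<le>N. q k * (if l = k + 1 then a k else if k = l + 1 then e k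
            else if k = l then - (a k + e k) else 0)) = 0)
         \<longleftrightarrow> (\<forall>l<N. q l * a l = q (Suc l) * e (Suc l))" (is "(\<forall>l\<le>N. ?S l = 0) \<longleftrightarrow> ?R")
proof -
  define F where "F l = (if l < N then q l * a l - q (Suc l) * e (Suc l) else 0)" for l
  have S: "?S l = (if l = 0 then 0 else F (l - 1)) - F l" if l: "l \<le> N" for l
  proof -
    have "?S l = (\<Sum>k\<le>N. (if k = l - 1 then (if l = 0 then 0 else q k * a k) else 0)
        + (if k = l + 1 then q k * e k else 0) + (if k = l then - q k * (a k + e k) else 0))"
    proof (rule sum.cong, rule refl)
      fix k
      consider "l = k + 1" | "k = l + 1" | "k = l" | "l \<noteq> k + 1" "k \<noteq> l + 1" "k \<noteq> l"
        by blast
      then show "q k * (if l = k + 1 then a k else if k = l + 1 then e k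
            else if k = l then - (a k + e k) else 0)
        = (if k = l - 1 then (if l = 0 then 0 else q k * a k) else 0)
          + (if k = l + 1 then q k * e k else 0) + (if k = l then - q k * (a k + e k) else 0)"
        by cases (auto simp: algebra_simps)
    qed
    also have "\<dots> = (if l = 0 then 0 else q (l - 1) * a (l - 1))
        + (if l < N then q (l + 1) * e (l + 1) else 0) - q l * (a l + e l)"
    proof -
      have "l - 1 \<le> N" using l by simp
      then show ?thesis using l by (simp add: sum.distrib)
    qed
    also have "\<dots> = (if l = 0 then 0 else F (l - 1)) - F l"
    proof -
      have 1: "F l = q l * a l - (if l < N then q (l + 1) * e (l + 1) else 0)"
        using l aN by (cases "l = N") (simp_all add: F_def)
      have 2: "(if l = 0 then 0 else F (l - 1))
          = (if l = 0 then 0 else q (l - 1) * a (l - 1)) - q l * e l"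
        using l e0 by (cases l) (simp_all add: F_def)
      show ?thesis unfolding 1 2 by (simp only: distrib_left)
    qed
    finally show ?thesis .
  qed
  have "(\<forall>l\<le>N. ?S l = 0) \<longleftrightarrow> (\<forall>l\<le>N. (if l = 0 then 0 else F (l - 1)) - F l = 0)"
    by (rule all_cong) (simp only: S)
  also have "\<dots> \<longleftrightarrow> ?R"
  proof
    assume *: "\<forall>l\<le>N. (if l = 0 then 0 else F (l - 1)) - F l = 0"
    have F: "F l = 0" if "l \<le> N" for l
      using that
    proof (induction l)
      case 0
      then show ?case using *[rule_format, of 0] by simp
    next
      case (Suc l)
      then show ?case using *[rule_format, of "Suc l"] by simp
    qed
    show ?R
    proof (intro allI impI)
      fix l assume "l < N"
      then show "q l * a l = q (Suc l) * e (Suc l)" using F[of l] by (simp add: F_def)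
    qed
  next
    assume ?R
    then have "F l = 0" for l by (simp add: F_def)
    then show "\<forall>l\<le>N. (if l = 0 then 0 else F (l - 1)) - F l = 0" by simp
  qed
  finally show ?thesis .
qed

lemma death_rate_pos:
  assumes "valid_params p" "0 < k"
  shows "0 < death_rate p d (st p k)"
proof -
  have "0 < mu1 p" "0 < mu2 p" "0 < real (n1 p)"
    using assms by (auto simp: valid_params_def)
  then show ?thesis
    using assms by (auto simp: death_rate_def st_def nu_def intro!: add_pos_nonneg)
qed

lemma is_stationary_iff:
  assumes p: "valid_params p"
  shows "is_stationary p d q \<longleftrightarrow> q \<in> extensional (Omega p) \<and>
     (\<forall>k\<le>n1 p + n2 p. 0 \<le> q (st p k)) \<and> (\<Sum>k\<le>n1 p + n2 p. q (st p k)) = 1 \<and>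
     (\<forall>k<n1 p + n2 p. q (st p k) * lam p = q (st p (Suc k)) * death_rate p d (st p (Suc k)))"
proof -
  let ?a = "\<lambda>k. birth_rate p (st p k)" and ?e = "\<lambda>k. death_rate p d (st p k)"
  have top: "st p (n1 p + n2 p) = (n1 p, n2 p)"
    using p by (auto simp: st_def valid_params_def)
  have a: "?a k = lam p" if "k < n1 p + n2 p" for k
    using that top st_eq_iff[of p k "n1 p + n2 p"] by (simp add: birth_rate_def)
  have aN: "?a (n1 p + n2 p) = 0" using top by (simp add: birth_rate_def)
  have e0: "?e 0 = 0" by (simp add: st_def death_rate_def)
  have "(\<forall>y\<in>Omega p. (\<Sum>x\<in>Omega p. q x * B p d x y) = 0) \<longleftrightarrow>
     (\<forall>k<n1 p + n2 p. q (st p k) * ?a k = q (st p (Suc k)) * ?e (Suc k))"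
    unfolding ball_Omega sum_Omega B_def pos_st st_eq_iff
    using balance_iff[of ?e ?a "n1 p + n2 p" "\<lambda>k. q (st p k)", OF e0 aN] .
  also have "\<dots> \<longleftrightarrow> (\<forall>k<n1 p + n2 p. q (st p k) * lam p = q (st p (Suc k)) * ?e (Suc k))"
    using a by auto
  finally show ?thesis
    unfolding is_stationary_def by (simp only: ball_Omega sum_Omega)
qed

lemma ex1_stationary:
  assumes p: "valid_params p"
  shows "\<exists>!q. is_stationary p d q"
proof -
  let ?N = "n1 p + n2 p" and ?e = "\<lambda>k. death_rate p d (st p k)"
  define w where "w k = (\<Prod>i\<in>{1..k}. lam p / ?e i)" for k
  have lam: "0 < lam p" using p by (simp add: valid_params_def)
  have epos: "0 < ?e (Suc k)" for k using death_rate_pos[OF p] by simp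
  have w0: "w 0 = 1" by (simp add: w_def)
  have wS: "w (Suc k) = w k * (lam p / ?e (Suc k))" for k by (simp add: w_def)
  have wpos: "0 < w k" for k
    by (induction k) (use epos lam in \<open>simp_all add: w0 wS\<close>)
  define W where "W = (\<Sum>k\<le>?N. w k)"
  have W: "0 < W" unfolding W_def by (intro sum_pos) (auto simp: wpos)
  define q0 where "q0 = restrict (\<lambda>x. w (pos x) / W) (Omega p)"
  have q0: "q0 (st p k) = w k / W" if "k \<le> ?N" for k
    using that bij_st[of p] by (auto simp: q0_def bij_betw_def)
  have "is_stationary p d q0"
    unfolding is_stationary_iff[OF p]
  proof (intro conjI allI impI)
    show "q0 \<in> extensional (Omega p)" by (simp add: q0_def)
    show "0 \<le> q0 (st p k)" if "k \<le> ?N" for k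
      using q0[OF that] wpos[of k] W by simp
    have "(\<Sum>k\<le>?N. q0 (st p k)) = (\<Sum>k\<le>?N. w k / W)"
      by (rule sum.cong) (auto simp: q0)
    also have "\<dots> = W / W" by (simp add: W_def flip: sum_divide_distrib)
    finally show "(\<Sum>k\<le>?N. q0 (st p k)) = 1" using W by simp
    show "q0 (st p k) * lam p = q0 (st p (Suc k)) * ?e (Suc k)" if "k < ?N" for k
      using that epos[of k] by (simp add: q0 wS)
  qed
  moreover have "q = q0" if q: "is_stationary p d q" for q
  proof -
    note q' = q[unfolded is_stationary_iff[OF p]]
    have qw: "q (st p k) = q (st p 0) * w k" if "k \<le> ?N" for k
      using that
    proof (induction k)
      case 0
      then show ?case by (simp add: w0)
    next
      case (Suc k)
      then have "q (st p (Suc k)) * ?e (Suc k) = q (st p 0) * w k * lam p"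
        using q' by (metis Suc_le_lessD less_imp_le_nat)
      then show ?case using epos[of k] by (simp add: wS field_simps)
    qed
    have "1 = (\<Sum>k\<le>?N. q (st p k))" using q' by simp
    also have "\<dots> = (\<Sum>k\<le>?N. q (st p 0) * w k)" by (rule sum.cong) (auto intro: qw)
    also have "\<dots> = q (st p 0) * W" by (simp add: W_def sum_distrib_left)
    finally have "q (st p 0) = 1 / W" using W by (simp add: field_simps)
    then have "q (st p k) = q0 (st p k)" if "k \<le> ?N" for k
      by (subst qw[OF that]) (simp add: q0[OF that])
    then have "\<forall>x\<in>Omega p. q x = q0 x"
      unfolding ball_Omega by blast
    moreover have "q \<in> extensional (Omega p)" "q0 \<in> extensional (Omega p)"
      using q' by (simp_all add: q0_def)
    ultimately show ?thesis by (intro extensionalityI) auto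
  qed
  ultimately show ?thesis by blast
qed

lemma is_stationary_stat: "valid_params p \<Longrightarrow> is_stationary p d (stat p d)"
  unfolding stat_def by (rule theI'[OF ex1_stationary])

end

theory Submission
  imports Defs
begin

text \<open>
  Write \<open>N = n + m\<close> and \<open>g\<^sub>k\<close> for the value of \<open>g\<close> at the state number \<open>k\<close>. Eliminating
  \<open>g\<^sub>N, g\<^bsub>N-1\<^esub>, \<dots>\<close> from the tridiagonal Poisson equation turns row \<open>k\<close> into
  \<open>- U\<^sub>k g\<^sub>k = A\<^sub>2\<^sup>(\<^sup>k\<^sup>) g\<^bsub>k-1\<^esub> + E\<^sub>k\<close>, where \<open>E\<^sub>N = h\<^sub>N\<close> and \<open>E\<^sub>k = h\<^sub>k + R\<^sub>k E\<^bsub>k+1\<^esub>\<close>. Hence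
  \<open>g\<^sub>k = G\<^sub>k g\<^bsub>k-1\<^esub> + (- U\<^sub>k)\<^sup>-\<^sup>1 E\<^sub>k\<close>, a first order recursion started at \<open>g\<^sub>0 = 1\<close>. The pivots
  do not vanish, since the row sums of the generator are zero and so \<open>- U\<^sub>k = A\<^sub>2\<^sup>(\<^sup>k\<^sup>)\<close>.
\<close>

lemma A2_eq_death_rate: "A2 p d k = death_rate p d (st p k)"
  by (auto simp: A2_def death_rate_def st_def)

lemma A1_eq: "A1 p d k = - (lam p + A2 p d k)"
  by (simp add: A1_def A2_def)

lemma A2_pos: "valid_params p \<Longrightarrow> 0 < k \<Longrightarrow> 0 < A2 p d k"
  by (simp add: A2_eq_death_rate death_rate_pos)

text \<open>Downward induction: once \<open>- U p d (Suc k)\<close> equals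
  \<open>A2 p d (Suc k)\<close>, the correction term of the recursion is exactly
  \<open>lam p\<close> and cancels the \<open>lam p\<close> in \<open>A1\<close>.\<close>

lemma U_eq:
  assumes p: "valid_params p" and k: "k \<le> n1 p + n2 p"
  shows "U p d k = - A2 p d k"
  using k
proof (induction k rule: inc_induct)
  case base
  then show ?case
    using p by (subst U.simps) (auto simp: A2_def valid_params_def)
next
  case (step k)
  have "A2 p d (Suc k) \<noteq> 0"
    using A2_pos[OF p, of "Suc k" d] by simp
  then show ?case
    using step by (subst U.simps) (simp add: A1_eq)
qed

text \<open>At \<open>k = 1\<close> both branches of \<open>Gm\<close> agree, because
  \<open>1 \<le> n1 p\<close> gives \<open>A2 p d 1 = mu1 p\<close>.\<close>

lemma Gm_eq: "Gm p d k = inverse (- U p d k) * A2 p d k" if "valid_params p"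
  using that by (auto simp: Gm_def A2_def valid_params_def)

text \<open>The row sums of the generator vanish, so only differences to the neighbours remain. The
  last state has no birth, and \<open>1 \<le> k\<close> makes position \<open>k - 1\<close> a true
  predecessor.\<close>

lemma B_row_sum:
  assumes p: "valid_params p" and k: "1 \<le> k" "k \<le> n1 p + n2 p"
  shows "(\<Sum>y\<in>Omega p. B p d (st p k) y * g y) =
    (if k = n1 p + n2 p then 0 else lam p * (g (st p (Suc k)) - g (st p k)))
    + A2 p d k * (g (st p (k - 1)) - g (st p k))"
proof -
  let ?N = "n1 p + n2 p" and ?b = "birth_rate p (st p k)"
  have b: "?b = (if k = ?N then 0 else lam p)"
  proof -
    have "st p ?N = (n1 p, n2 p)"
      using p by (auto simp: st_def valid_params_def)
    then show ?thesis
      using st_eq_iff[of p k ?N] by (simp add: birth_rate_def)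
  qed
  \<comment> \<open>The positions \<open>k - 1\<close>, \<open>k\<close>, \<open>Suc k\<close> are
    distinct, so the nested conditional splits into three indicator terms, each picking at most one
    summand.\<close>
  have "(\<Sum>y\<in>Omega p. B p d (st p k) y * g y) =
    (\<Sum>j\<le>?N. (if j = Suc k then ?b * g (st p j) else 0)
      + (if j = k - 1 then A2 p d k * g (st p j) else 0)
      + (if j = k then - (?b + A2 p d k) * g (st p j) else 0))"
    unfolding sum_Omega B_def pos_st st_eq_iff
    by (rule sum.cong) (use k in \<open>auto simp: A2_eq_death_rate\<close>)
  also have "\<dots> = (if Suc k \<le> ?N then ?b * g (st p (Suc k)) else 0)
      + A2 p d k * g (st p (k - 1)) - (?b + A2 p d k) * g (st p k)"
  proof -
    have "k - 1 \<le> ?N" using k by simp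
    then show ?thesis using k by (simp add: sum.distrib algebra_simps)
  qed
  finally show ?thesis
    using k by (auto simp: b algebra_simps)
qed

text \<open>The inhomogeneity of row \<open>i\<close> after eliminating all higher unknowns, in
  unrolled form. The half-open product range is empty at \<open>l = i\<close>, which yields the
  leading \<open>h p d i\<close>.\<close>

definition E :: "params \<Rightarrow> policy \<Rightarrow> nat \<Rightarrow> real" where
  "E p d i = (\<Sum>l=i..n1 p + n2 p. (\<Prod>j\<in>{i..<l}. Rm p d j) * h p d l)"

lemma E_top: "E p d (n1 p + n2 p) = h p d (n1 p + n2 p)"
  by (simp add: E_def)

lemma E_rec:
  assumes "i < n1 p + n2 p"
  shows "E p d i = h p d i + Rm p d i * E p d (Suc i)"
proof -
  let ?N = "n1 p + n2 p"
  have "(\<Sum>l=Suc i..?N. (\<Prod>j\<in>{i..<l}. Rm p d j) * h p d l) = Rm p d i * E p d (Suc i)"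
    unfolding E_def sum_distrib_left
    by (rule sum.cong) (simp_all add: prod.atLeast_Suc_lessThan mult.assoc)
  then show ?thesis
    using assms by (simp add: E_def sum.atLeast_Suc_atMost[of i])
qed

lemma E_eq_X:
  assumes "i \<le> n1 p + n2 p"
  shows "E p d i = h p d i + (\<Sum>j=2..n2 p + n1 p - i + 1. X p d j i * h p d (j + i - 1))"
proof -
  have "(\<Sum>j=2..n2 p + n1 p - i + 1. X p d j i * h p d (j + i - 1)) =
      (\<Sum>l=Suc i..n1 p + n2 p. (\<Prod>j\<in>{i..<l}. Rm p d j) * h p d l)"
  \<comment> \<open>Substitution \<open>l = j + i - 1\<close>: for \<open>j \<ge> 2\<close>,
    \<open>X p d j i\<close> has \<open>j - 1\<close> factors, with indices \<open>i\<close> to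
    \<open>l - 1\<close>.\<close>
  proof (rule sum.reindex_bij_witness[where i = "\<lambda>l. Suc l - i" and j = "\<lambda>j. j + i - 1"])
    fix j assume "j \<in> {2..n2 p + n1 p - i + 1}"
    then have "{i..i + j - 2} = {i..<j + i - 1}" by auto
    then show "(\<Prod>j\<in>{i..<j + i - 1}. Rm p d j) * h p d (j + i - 1) =
        X p d j i * h p d (j + i - 1)"
      by (simp only: X_def)
  qed (use assms in auto)
  then show ?thesis
    using assms by (simp add: E_def sum.atLeast_Suc_atMost)
qed

lemma potential_row:
  assumes "is_potential p d g" "k \<le> n1 p + n2 p"
  shows "- (\<Sum>y\<in>Omega p. B p d (st p k) y * g y) = h p d k"
proof -
  have "h p d k = reward p d (st p k) - eta p d" by (simp add: h_def st_def)
  then show ?thesis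
    using assms unfolding is_potential_def ball_Omega by simp
qed

lemma potential_pivot:
  assumes p: "valid_params p" and g: "is_potential p d g"
    and k: "1 \<le> k" "k \<le> n1 p + n2 p"
  shows "- U p d k * g (st p k) = A2 p d k * g (st p (k - 1)) + E p d k"
  using k(2,1)
proof (induction k rule: inc_induct)
  case base
  let ?N = "n1 p + n2 p"
  \<comment> \<open>The last row involves no higher unknown, so nothing has to be eliminated from
    it.\<close>
  have "A2 p d ?N * (g (st p (?N - 1)) - g (st p ?N)) = - h p d ?N"
    using potential_row[OF g order.refl] B_row_sum[OF p base order.refl, of d g] by simp
  then show ?case
    using U_eq[OF p order.refl, of d] by (simp add: E_top algebra_simps)
next
  case (step k)
  have k: "k \<le> n1 p + n2 p" using step by simp
  have "0 < - U p d (Suc k)"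
    using U_eq[OF p, of "Suc k" d] A2_pos[OF p, of "Suc k" d] step by simp
  then have "g (st p (Suc k)) =
      inverse (- U p d (Suc k)) * (A2 p d (Suc k) * g (st p k) + E p d (Suc k))"
    using step by (simp add: field_simps)
  \<comment> \<open>Substituted into row \<open>k\<close>, the first summand supplies the correction
    that turns \<open>A1\<close> into \<open>U\<close>, the second the term that turns
    \<open>h\<close> into \<open>E\<close>.\<close>
  then have *: "lam p * g (st p (Suc k)) =
      lam p * inverse (- U p d (Suc k)) * A2 p d (Suc k) * g (st p k) + Rm p d k * E p d (Suc k)"
    by (simp only: Rm_def Suc_eq_plus1 distrib_left mult.assoc)
  have U: "U p d k = A1 p d k + lam p * inverse (- U p d (Suc k)) * A2 p d (Suc k)"
    using step by (subst U.simps) simp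
  have "h p d k = - (lam p * (g (st p (Suc k)) - g (st p k))
      + A2 p d k * (g (st p (k - 1)) - g (st p k)))"
    using potential_row[OF g k] B_row_sum[OF p _ k, of d g] step by simp
  then have "h p d k = - (lam p * g (st p (Suc k))) - A1 p d k * g (st p k)
      - A2 p d k * g (st p (k - 1))"
    by (simp add: A1_eq algebra_simps)
  then show ?case
    unfolding E_rec[OF step(2)] U * by (simp add: algebra_simps)
qed

lemma potential_step:
  assumes p: "valid_params p" and g: "is_potential p d g"
    and k: "1 \<le> k" "k \<le> n1 p + n2 p"
  shows "g (st p k) = inverse (- U p d k) * E p d k + Gm p d k * g (st p (k - 1))"
proof -
  have "0 < - U p d k"
    using U_eq[OF p k(2), of d] A2_pos[OF p, of k d] k by simp
  then have "g (st p k) = inverse (- U p d k) * (- U p d k * g (st p k))"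
    by simp
  also have "\<dots> = inverse (- U p d k) * E p d k + Gm p d k * g (st p (k - 1))"
    unfolding potential_pivot[OF assms] Gm_eq[OF p] by (simp only: distrib_left mult.assoc add.commute)
  finally show ?thesis .
qed

text \<open>Variation of constants: the inhomogeneity \<open>a i\<close> entering at index
  \<open>i\<close> is multiplied by all later coefficients up to \<open>c k\<close>, the initial
  value by all of them.\<close>

lemma linear_recursion_solution:
  fixes x a c :: "nat \<Rightarrow> 'a::comm_ring_1"
  assumes "\<And>k. 1 \<le> k \<Longrightarrow> k \<le> N \<Longrightarrow> x k = a k + c k * x (k - 1)" and "k \<le> N"
  shows "x k = (\<Sum>i=1..k. (\<Prod>j=i+1..k. c j) * a i) + (\<Prod>j=1..k. c j) * x 0"
  using assms(2)
proof (induction k)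
  case 0
  then show ?case by simp
next
  case (Suc k)
  have "(\<Prod>j=i+1..Suc k. c j) = c (Suc k) * (\<Prod>j=i+1..k. c j)" if "i \<in> {1..k}" for i
    using that by (simp add: prod.nat_ivl_Suc')
  then have "(\<Sum>i=1..k. (\<Prod>j=i+1..Suc k. c j) * a i) =
      c (Suc k) * (\<Sum>i=1..k. (\<Prod>j=i+1..k. c j) * a i)"
    unfolding sum_distrib_left by (intro sum.cong) (simp_all add: mult.assoc)
  then show ?case
    using Suc assms(1)[of "Suc k"] by (simp add: algebra_simps)
qed

lemma potential_eq:
  assumes p: "valid_params p" and g: "is_potential p d g" and g0: "g (0, 0) = 1"
    and k: "1 \<le> k" "k \<le> n1 p + n2 p"
  shows "g (st p k) =
    inverse (- U p d k) *
      (h p d k + (\<Sum>j=2..n2 p + n1 p - k + 1. X p d j k * h p d (j + k - 1)))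
    + (\<Sum>i=1..k - 1. Y p d (k - i + 1) k * inverse (- U p d i) *
        (h p d i + (\<Sum>j=2..n2 p + n1 p - i + 1. X p d j i * h p d (j + i - 1))))
    + (\<Prod>j=1..k. Gm p d j)"
proof -
  have st0: "g (st p 0) = 1" using g0 by (simp add: st_def)
  have Y: "Y p d (k - i + 1) k = (\<Prod>j=i+1..k. Gm p d j)" if "i \<in> {1..k - 1}" for i
  proof -
    \<comment> \<open>The lower end of the product range in \<open>Y\<close>; the subtraction does
      not truncate, since \<open>1 \<le> i\<close>.\<close>
    have "k - (k - i + 1) + 2 = i + 1" using that by auto
    then show ?thesis by (simp only: Y_def)
  qed
  have "g (st p k) = (\<Sum>i=1..k. (\<Prod>j=i+1..k. Gm p d j) * (inverse (- U p d i) * E p d i))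
      + (\<Prod>j=1..k. Gm p d j)"
    using linear_recursion_solution[where x = "\<lambda>k. g (st p k)", OF potential_step[OF p g] k(2)] st0
    by simp
  \<comment> \<open>The summand \<open>i = k\<close> has an empty product and is split off; for the
    others the subscript \<open>k - i + 1\<close> of \<open>Y\<close> is at least 2.\<close>
  also have "(\<Sum>i=1..k. (\<Prod>j=i+1..k. Gm p d j) * (inverse (- U p d i) * E p d i)) =
      inverse (- U p d k) * E p d k
      + (\<Sum>i=1..k - 1. (\<Prod>j=i+1..k. Gm p d j) * (inverse (- U p d i) * E p d i))"
    using k by (cases k) simp_all
  also have "(\<Sum>i=1..k - 1. (\<Prod>j=i+1..k. Gm p d j) * (inverse (- U p d i) * E p d i)) =
      (\<Sum>i=1..k - 1. Y p d (k - i + 1) k * inverse (- U p d i) *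
        (h p d i + (\<Sum>j=2..n2 p + n1 p - i + 1. X p d j i * h p d (j + i - 1))))"
  proof (rule sum.cong[OF refl])
    fix i assume i: "i \<in> {1..k - 1}"
    then have "i \<le> n1 p + n2 p" using k by auto
    then show "(\<Prod>j=i+1..k. Gm p d j) * (inverse (- U p d i) * E p d i) =
        Y p d (k - i + 1) k * inverse (- U p d i) *
        (h p d i + (\<Sum>j=2..n2 p + n1 p - i + 1. X p d j i * h p d (j + i - 1)))"
      unfolding Y[OF i] by (simp only: E_eq_X mult.assoc)
  qed
  finally show ?thesis unfolding E_eq_X[OF k(2)] .
qed

theorem theorem2:
  fixes p :: params and d :: policy and g :: "state \<Rightarrow> real"
  assumes "valid_params p"
    and "d \<in> policies p"
    and "is_potential p d g"
    and "g (0, 0) = 1"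
  shows
    "g (1, 0) =
       inverse (- U p d 1) * (h p d 1 + (\<Sum>j=2..n2 p + n1 p. X p d j 1 * h p d j)) + Gm p d 1 \<and>
     (\<forall>k. 2 \<le> k \<and> k \<le> n1 p \<longrightarrow>
       g (k, 0) =
         inverse (- U p d k) *
           (h p d k + (\<Sum>j=2..n2 p + n1 p - k + 1. X p d j k * h p d (j + k - 1)))
         + (\<Sum>i=1..k - 1. Y p d (k - i + 1) k * inverse (- U p d i) *
             (h p d i + (\<Sum>j=2..n2 p + n1 p - i + 1. X p d j i * h p d (j + i - 1))))
         + (\<Prod>j=1..k. Gm p d j)) \<and>
     (\<forall>k. n1 p + 1 \<le> k \<and> k \<le> n1 p + n2 p - 1 \<longrightarrow>
       g (n1 p, k - n1 p) =
         inverse (- U p d k) *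
           (h p d k + (\<Sum>j=2..n2 p + n1 p - k + 1. X p d j k * h p d (j + k - 1)))
         + (\<Sum>i=1..k - 1. Y p d (k - i + 1) k * inverse (- U p d i) *
             (h p d i + (\<Sum>j=2..n2 p + n1 p - i + 1. X p d j i * h p d (j + i - 1))))
         + (\<Prod>j=1..k. Gm p d j)) \<and>
     g (n1 p, n2 p) =
       inverse (- U p d (n1 p + n2 p)) * h p d (n1 p + n2 p)
       + (\<Sum>i=1..n1 p + n2 p - 1. Y p d (n1 p + n2 p - i + 1) (n1 p + n2 p) * inverse (- U p d i) *
           (h p d i + (\<Sum>j=2..n2 p + n1 p - i + 1. X p d j i * h p d (j + i - 1))))
       + (\<Prod>j=1..n1 p + n2 p. Gm p d j)"
proof -
  note eq = potential_eq[OF assms(1,3,4)]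
  have n: "1 \<le> n1 p" "1 \<le> n2 p" using assms(1) by (simp_all add: valid_params_def)
  let ?N = "n1 p + n2 p"
  have st1: "st p 1 = (1, 0)" and stN: "st p ?N = (n1 p, n2 p)"
    and st_low: "k \<le> n1 p \<Longrightarrow> st p k = (k, 0)"
    and st_high: "n1 p + 1 \<le> k \<Longrightarrow> st p k = (n1 p, k - n1 p)" for k
    using n by (auto simp: st_def)
  have first: "n2 p + n1 p - 1 + 1 = n2 p + n1 p" using n by simp
  show ?thesis
  proof (intro conjI allI impI; (elim conjE)?)
    show "g (1, 0) = inverse (- U p d 1) *
        (h p d 1 + (\<Sum>j=2..n2 p + n1 p. X p d j 1 * h p d j)) + Gm p d 1"
      \<comment> \<open>For \<open>k = 1\<close> there is no earlier index \<open>i\<close>, and the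
        product is the single factor \<open>Gm p d 1\<close>.\<close>
      using eq[of 1, unfolded st1 first] n by simp
  next
    fix k assume k: "2 \<le> k" "k \<le> n1 p"
    show "g (k, 0) =
         inverse (- U p d k) *
           (h p d k + (\<Sum>j=2..n2 p + n1 p - k + 1. X p d j k * h p d (j + k - 1)))
         + (\<Sum>i=1..k - 1. Y p d (k - i + 1) k * inverse (- U p d i) *
             (h p d i + (\<Sum>j=2..n2 p + n1 p - i + 1. X p d j i * h p d (j + i - 1))))
         + (\<Prod>j=1..k. Gm p d j)"
      unfolding st_low[OF k(2), symmetric] by (rule eq) (use k in auto)
  next
    fix k assume k: "n1 p + 1 \<le> k" "k \<le> n1 p + n2 p - 1"
    show "g (n1 p, k - n1 p) =
         inverse (- U p d k) *
           (h p d k + (\<Sum>j=2..n2 p + n1 p - k + 1. X p d j k * h p d (j + k - 1)))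
         + (\<Sum>i=1..k - 1. Y p d (k - i + 1) k * inverse (- U p d i) *
             (h p d i + (\<Sum>j=2..n2 p + n1 p - i + 1. X p d j i * h p d (j + i - 1))))
         + (\<Prod>j=1..k. Gm p d j)"
      unfolding st_high[OF k(1), symmetric] by (rule eq) (use k in auto)
  next
    \<comment> \<open>At the last position the range is \<open>{2..1}\<close>, so the first bracket
      reduces to \<open>h\<close>.\<close>
    have "(\<Sum>j=2..n2 p + n1 p - ?N + 1. X p d j ?N * h p d (j + ?N - 1)) = 0" by simp
    then show "g (n1 p, n2 p) =
       inverse (- U p d (n1 p + n2 p)) * h p d (n1 p + n2 p)
       + (\<Sum>i=1..n1 p + n2 p - 1. Y p d (n1 p + n2 p - i + 1) (n1 p + n2 p) * inverse (- U p d i) *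
           (h p d i + (\<Sum>j=2..n2 p + n1 p - i + 1. X p d j i * h p d (j + i - 1))))
       + (\<Prod>j=1..n1 p + n2 p. Gm p d j)"
      using eq[of ?N, unfolded stN] n by (simp only: add_0_right)
  qed
qed

end
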